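(* Let $L>0$ and $c>0$, and let $\omega_0,\theta_0\in C^\infty(\mathbb{R}/L\mathbb{Z})$ be real-valued. Assume that $\omega_0$ and $\theta_{0x}=\partial_x\theta_0$ are odd with respect to both $x=0$ and $x=L/2$, that $$\omega_0(x)\ge 0,\qquad \theta_{0x}(x)\ge 0,\qquad 0\le x\le L/2,$$ and that $F(0)>0$, where $$F(t):=c\int_0^{L/2}\frac{\omega(x,t)}{x}\,dx,\qquad\text{so that}\qquad F(0)=c\int_0^{L/2}\frac{\omega_0(x)}{x}\,dx .$$ Then any smooth solution $(\omega,\theta)$ of the system $$\left\{\begin{aligned} &\omega_t+u\,\omega_x=\theta_x,\qquad x\in\mathbb{R}/L\mathbb{Z},\ t\in[0,T),\\ &\theta_t+u\,\theta_x=0,\\ &u=-c\,\omega, \end{aligned}\right.$$ with initial data $\omega(\cdot,0)=\omega_0$, $\theta(\cdot,0)=\theta_0$ blows up in finite time. More precisely, its maximal smooth lifespan satisfies $$T_{\max}\le\frac{L}{F(0)} .$$ In particular, in the normalization $L=2$, $T_{\max}\le 2/F(0)$.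
   Context: A function $f$ on $\mathbb{R}/L\mathbb{Z}$ is odd with respect to a point $x_0$ if $f(x_0+y)=-f(x_0-y)$ for all $y$. Subscripts $t,x$ denote partial derivatives. The maximal smooth lifespan $T_{\max}$ of a solution is the supremum of the times $T$ for which it is (extends as) a smooth solution on $\mathbb{R}/L\mathbb{Z}\times[0,T)$; blow-up in finite time means $T_{\max}<\infty$. The system is the closed boundary-jet system $(Q0)$ when $c=(m+2)^{-1}$ with $m\in\{1,2\}$; the statement is for arbitrary $c>0$. *)

theory Defs
  imports "HOL-Analysis.Analysis" "HOL-Library.Periodic_Fun"
begin

text \<open>
  Functions on \<open>\<real>/L\<int>\<close> are \<open>L\<close>-periodic functions on the line (\<^const>\<open>periodic_fun_simple\<close>).

  Derivatives are taken within \<open>S\<close>, so that on a space-time slab closed at \<open>t = 0\<close> smoothness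
  includes smoothness up to the initial time. For the convex sets with nonempty interior used
  below, derivatives within the set are unique, so the existential quantifier is harmless.
\<close>

primrec Ck_on :: "nat \<Rightarrow> 'a::real_normed_vector set \<Rightarrow> ('a \<Rightarrow> 'b::real_normed_vector) \<Rightarrow> bool" where
  "Ck_on 0 S f \<longleftrightarrow> continuous_on S f"
| "Ck_on (Suc k) S f \<longleftrightarrow>
     (\<exists>f'. (\<forall>z\<in>S. (f has_derivative f' z) (at z within S)) \<and> (\<forall>v. Ck_on k S (\<lambda>z. f' z v)))"

definition smooth_on :: "'a::real_normed_vector set \<Rightarrow> ('a \<Rightarrow> 'b::real_normed_vector) \<Rightarrow> bool" where
  "smooth_on S f \<longleftrightarrow> (\<forall>k. Ck_on k S f)"

definition odd_about :: "(real \<Rightarrow> real) \<Rightarrow> real \<Rightarrow> bool" where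
  "odd_about f x0 \<longleftrightarrow> (\<forall>y. f (x0 + y) = - f (x0 - y))"

text \<open>
  Space-time functions are curried with time first, so that \<open>\<omega> t\<close> is the spatial profile at
  time \<open>t\<close>. Lifespans are extended reals, which admits global solutions (\<open>T = \<infinity>\<close>).
\<close>

definition time_interval :: "ereal \<Rightarrow> real set" where
  "time_interval T = {t. 0 \<le> t \<and> ereal t < T}"

definition partial_x :: "(real \<Rightarrow> real \<Rightarrow> real) \<Rightarrow> real \<Rightarrow> real \<Rightarrow> real" where
  "partial_x f t x = deriv (f t) x"

text \<open>One-sided at \<open>t = 0\<close>.\<close>

definition partial_t :: "ereal \<Rightarrow> (real \<Rightarrow> real \<Rightarrow> real) \<Rightarrow> real \<Rightarrow> real \<Rightarrow> real" where
  "partial_t T f t x = vector_derivative (\<lambda>s. f s x) (at t within time_interval T)"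

definition smooth_solution ::
    "real \<Rightarrow> real \<Rightarrow> ereal \<Rightarrow> (real \<Rightarrow> real \<Rightarrow> real) \<Rightarrow> (real \<Rightarrow> real \<Rightarrow> real) \<Rightarrow> bool" where
  "smooth_solution L c T \<omega> \<theta> \<longleftrightarrow>
     0 < T \<and>
     smooth_on (time_interval T \<times> UNIV) (\<lambda>(t, x). \<omega> t x) \<and>
     smooth_on (time_interval T \<times> UNIV) (\<lambda>(t, x). \<theta> t x) \<and>
     (\<forall>t\<in>time_interval T. periodic_fun_simple (\<omega> t) L \<and> periodic_fun_simple (\<theta> t) L) \<and>
     (let u = (\<lambda>t x. - c * \<omega> t x) in
       \<forall>t\<in>time_interval T. \<forall>x.
         partial_t T \<omega> t x + u t x * partial_x \<omega> t x = partial_x \<theta> t x \<and>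
         partial_t T \<theta> t x + u t x * partial_x \<theta> t x = 0)"

definition maximal_lifespan ::
    "real \<Rightarrow> real \<Rightarrow> ereal \<Rightarrow> (real \<Rightarrow> real \<Rightarrow> real) \<Rightarrow> (real \<Rightarrow> real \<Rightarrow> real) \<Rightarrow> ereal" where
  "maximal_lifespan L c T \<omega> \<theta> =
     Sup {T'. T \<le> T' \<and> (\<exists>\<omega>' \<theta>'. smooth_solution L c T' \<omega>' \<theta>' \<and>
                (\<forall>t\<in>time_interval T. \<omega>' t = \<omega> t \<and> \<theta>' t = \<theta> t))}"

definition blows_up_in_finite_time ::
    "real \<Rightarrow> real \<Rightarrow> ereal \<Rightarrow> (real \<Rightarrow> real \<Rightarrow> real) \<Rightarrow> (real \<Rightarrow> real \<Rightarrow> real) \<Rightarrow> bool" where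
  "blows_up_in_finite_time L c T \<omega> \<theta> \<longleftrightarrow> maximal_lifespan L c T \<omega> \<theta> < \<infinity>"

text \<open>The integrand takes the junk value \<open>\<omega> t 0 / 0 = 0\<close> at the left endpoint, a null set.\<close>

definition F_functional :: "real \<Rightarrow> real \<Rightarrow> (real \<Rightarrow> real \<Rightarrow> real) \<Rightarrow> real \<Rightarrow> real" where
  "F_functional L c \<omega> t = c * integral {0..L/2} (\<lambda>x. \<omega> t x / x)"

end

theory Submission
  imports Defs
begin

text \<open>
  Write \<open>a = L/2\<close> and \<open>r = \<theta>\<^sub>x\<close>. Multiplying \<open>\<omega>\<^sub>t = c \<omega> \<omega>\<^sub>x + r\<close> by the weight \<open>1/x\<close> and
  integrating the Burgers term by parts over \<open>[0, a]\<close> gives, if \<open>\<omega>\<close> vanishes at both ends,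
  \<open>F' = c\<^sup>2/2 \<integral> \<omega>\<^sup>2/x\<^sup>2 + c \<integral> r/x\<close>. If moreover \<open>r \<ge> 0\<close>, the Cauchy-Schwarz inequality yields the
  Riccati inequality \<open>F' \<ge> F\<^sup>2/(2a)\<close>, so \<open>F\<close> blows up no later than \<open>2a/F(0) = L/F(0)\<close>.

  The singular weight is avoided at positive times: the same computation with \<open>1/(x + \<delta>)\<close>, \<open>\<delta> > 0\<close>,
  gives exactly the same Riccati inequality for the regularized functional (\<open>moment_riccati\<close>).
  Hence the lifespan is at most \<open>L/F\<^sub>\<delta>(0)\<close> for every \<open>\<delta>\<close> with \<open>F\<^sub>\<delta>(0) > 0\<close>, and the passage \<open>\<delta> \<rightarrow> 0\<close> only
  involves the initial datum (\<open>regularized_integral_tendsto\<close>).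

  Two properties must persist in time. At a point where \<open>\<omega>\<close> and \<open>r\<close> both vanish initially, as
  oddness ensures at \<open>0\<close> and \<open>a\<close>, the pair \<open>(\<omega>, r)\<close> solves a homogeneous linear system of
  ordinary differential equations in time, whose coefficients are read off from the solution
  itself; so it stays zero (\<open>stagnation_point\<close>). The sign of \<open>r\<close> persists by a maximum
  principle for the transport equation \<open>r\<^sub>t = c (\<omega> r)\<^sub>x\<close> (\<open>density_gradient_nonneg\<close>), which
  follows from the equation for \<open>\<theta>\<close> by exchanging the two partial derivatives
  (\<open>mixed_partial\<close>).

  The bound holds for the lifespan of every smooth solution with these initial data, hence for
  the supremum over all extensions of the given one.
\<close>

section \<open>Differential inequalities\<close>

lemma nonneg_derivative_within_imp_le:
  fixes f :: "real \<Rightarrow> real"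
  assumes "\<And>t. t \<in> {0..b} \<Longrightarrow> (f has_real_derivative f' t) (at t within {0..b})"
    and "\<And>t. t \<in> {0..b} \<Longrightarrow> 0 \<le> f' t"
    and t: "t \<in> {0..b}"
  shows "f 0 \<le> f t"
proof (rule DERIV_nonneg_imp_increasing_open[where f = f])
  show "0 \<le> t" using t by simp
next
  fix s assume s: "0 < s" "s < t"
  then have "(f has_real_derivative f' s) (at s)"
    using assms(1)[of s] t by (simp add: at_within_Icc_at)
  then show "\<exists>y. (f has_real_derivative y) (at s) \<and> 0 \<le> y"
    using assms(2)[of s] s t by auto
next
  have "continuous_on {0..b} f"
    by (meson DERIV_continuous assms(1) continuous_on_eq_continuous_within)
  then show "continuous_on {0..t} f"
    by (rule continuous_on_subset) (use t in auto)
qed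

text \<open>
  The integrating factor \<open>exp (- K t)\<close> makes \<open>E\<close> nonincreasing.
\<close>

lemma gronwall_zero:
  fixes E :: "real \<Rightarrow> real"
  assumes der: "\<And>t. t \<in> {0..b} \<Longrightarrow> (E has_real_derivative E' t) (at t within {0..b})"
    and le: "\<And>t. t \<in> {0..b} \<Longrightarrow> E' t \<le> K * E t"
    and "E 0 = 0" and t: "t \<in> {0..b}"
  shows "E t \<le> 0"
proof -
  have "- exp (- K * 0) * E 0 \<le> - exp (- K * t) * E t"
  proof (rule nonneg_derivative_within_imp_le
      [where f = "\<lambda>t. - exp (- K * t) * E t" and f' = "\<lambda>t. exp (- K * t) * (K * E t - E' t)", OF _ _ t])
    fix s assume s: "s \<in> {0..b}"
    show "((\<lambda>t. - exp (- K * t) * E t) has_real_derivative exp (- K * s) * (K * E s - E' s))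
        (at s within {0..b})"
      by (auto intro!: derivative_eq_intros der[OF s] simp: algebra_simps)
    show "0 \<le> exp (- K * s) * (K * E s - E' s)"
      using le[OF s] by simp
  qed
  then show ?thesis
    using \<open>E 0 = 0\<close> by (simp add: mult_le_0_iff)
qed

text \<open>
  The energy \<open>a\<^sup>2 + e\<^sup>2\<close> satisfies the hypothesis of \<open>gronwall_zero\<close>: the diagonal terms of the
  system contribute at most \<open>2 P\<close> times the energy, and the cross terms \<open>2 (1 + q) a e\<close> at most
  \<open>1 + Q\<close> times.
\<close>

lemma linear_system_zero:
  fixes a e :: "real \<Rightarrow> real"
  assumes a: "\<And>t. t \<in> {0..b} \<Longrightarrow> (a has_real_derivative p t * a t + e t) (at t within {0..b})"
    and e: "\<And>t. t \<in> {0..b} \<Longrightarrow> (e has_real_derivative q t * a t + p t * e t) (at t within {0..b})"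
    and p: "\<And>t. t \<in> {0..b} \<Longrightarrow> \<bar>p t\<bar> \<le> P"
    and q: "\<And>t. t \<in> {0..b} \<Longrightarrow> \<bar>q t\<bar> \<le> Q"
    and "a 0 = 0" "e 0 = 0" and t: "t \<in> {0..b}"
  shows "a t = 0 \<and> e t = 0"
proof -
  have "(a t)\<^sup>2 + (e t)\<^sup>2 \<le> 0"
  proof (rule gronwall_zero[OF _ _ _ t])
    fix s assume s: "s \<in> {0..b}"
    let ?D = "2 * a s * (p s * a s + e s) + 2 * e s * (q s * a s + p s * e s)"
    show "((\<lambda>t. (a t)\<^sup>2 + (e t)\<^sup>2) has_real_derivative ?D) (at s within {0..b})"
      by (auto intro!: derivative_eq_intros a[OF s] e[OF s] simp: algebra_simps)
    have ae: "2 * \<bar>a s * e s\<bar> \<le> (a s)\<^sup>2 + (e s)\<^sup>2"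
      using sum_squares_bound[of "\<bar>a s\<bar>" "\<bar>e s\<bar>"] by (simp add: abs_mult)
    have 1: "p s * ((a s)\<^sup>2 + (e s)\<^sup>2) \<le> P * ((a s)\<^sup>2 + (e s)\<^sup>2)"
      using p[OF s] by (intro mult_right_mono) auto
    have "(1 + q s) * (2 * (a s * e s)) \<le> \<bar>1 + q s\<bar> * (2 * \<bar>a s * e s\<bar>)"
      using abs_ge_self[of "(1 + q s) * (2 * (a s * e s))"] by (simp add: abs_mult)
    also have "\<dots> \<le> (1 + Q) * ((a s)\<^sup>2 + (e s)\<^sup>2)"
      using q[OF s] ae by (intro mult_mono) auto
    finally show "?D \<le> (2 * P + (1 + Q)) * ((a s)\<^sup>2 + (e s)\<^sup>2)"
      using 1 by (simp add: algebra_simps power2_eq_square)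
  qed (use assms in auto)
  then show ?thesis
    by (simp add: sum_power2_le_zero_iff)
qed

text \<open>
  The inequality says that \<open>- 1/G - t/L\<close> is nondecreasing, while \<open>- 1/G\<close> stays negative because
  \<open>G\<close> is nondecreasing and starts positive.
\<close>

lemma riccati_lifespan:
  fixes G :: "real \<Rightarrow> real"
  assumes der: "\<And>t. t \<in> {0..b} \<Longrightarrow> (G has_real_derivative G' t) (at t within {0..b})"
    and le: "\<And>t. t \<in> {0..b} \<Longrightarrow> (G t)\<^sup>2 / L \<le> G' t"
    and "0 < L" "0 < G 0" "0 \<le> b"
  shows "b < L / G 0"
proof -
  have pos: "0 < G t" if "t \<in> {0..b}" for t
  proof -
    have "G 0 \<le> G t"
    proof (rule nonneg_derivative_within_imp_le[OF der _ that])
      fix s assume "s \<in> {0..b}"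
      then show "0 \<le> G' s"
        using le[of s] \<open>0 < L\<close> by (meson divide_nonneg_pos order_trans zero_le_power2)
    qed
    then show ?thesis using \<open>0 < G 0\<close> by simp
  qed
  have "- inverse (G 0) - 0 / L \<le> - inverse (G b) - b / L"
  proof (rule nonneg_derivative_within_imp_le[where f = "\<lambda>t. - inverse (G t) - t / L"
        and f' = "\<lambda>t. G' t / (G t)\<^sup>2 - 1 / L"])
    fix s assume s: "s \<in> {0..b}"
    show "((\<lambda>t. - inverse (G t) - t / L) has_real_derivative G' s / (G s)\<^sup>2 - 1 / L)
        (at s within {0..b})"
      using pos[OF s] \<open>0 < L\<close>
      by (auto intro!: derivative_eq_intros der[OF s] simp: field_simps power2_eq_square)
    show "0 \<le> G' s / (G s)\<^sup>2 - 1 / L"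
      using pos[OF s] le[OF s] \<open>0 < L\<close> by (simp add: field_simps)
  qed (use \<open>0 \<le> b\<close> in auto)
  moreover have "0 < inverse (G b)" using pos[of b] \<open>0 \<le> b\<close> by simp
  ultimately have "b / L < inverse (G 0)" by linarith
  then show ?thesis
    using \<open>0 < L\<close> \<open>0 < G 0\<close> by (simp add: field_simps)
qed

section \<open>Calculus on a space-time slab\<close>

lemma continuous_on_slab_compose:
  fixes f :: "real \<Rightarrow> real \<Rightarrow> real"
  assumes "continuous_on (I \<times> UNIV) (\<lambda>(t, x). f t x)"
    and "continuous_on S \<tau>" "continuous_on S \<xi>" "\<And>z. z \<in> S \<Longrightarrow> \<tau> z \<in> I"
  shows "continuous_on S (\<lambda>z. f (\<tau> z) (\<xi> z))"
  using continuous_on_compose2[OF assms(1), of S "\<lambda>z. (\<tau> z, \<xi> z)"] assms(2-)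
  by (auto intro: continuous_on_Pair)

lemma slab_bounded:
  fixes f :: "real \<Rightarrow> real \<Rightarrow> real"
  assumes "continuous_on ({0..b} \<times> UNIV) (\<lambda>(t, x). f t x)"
  obtains K where "\<And>t x. t \<in> {0..b} \<Longrightarrow> x \<in> {\<alpha>..\<beta>} \<Longrightarrow> \<bar>f t x\<bar> \<le> K"
proof -
  have "bounded ((\<lambda>(t, x). f t x) ` ({0..b} \<times> {\<alpha>..\<beta>}))"
    by (intro compact_imp_bounded compact_continuous_image compact_Times compact_Icc
        continuous_on_subset[OF assms]) auto
  then obtain K where "\<forall>y\<in>(\<lambda>(t, x). f t x) ` ({0..b} \<times> {\<alpha>..\<beta>}). norm y \<le> K"
    by (auto simp: bounded_iff)
  then show thesis by (intro that[of K]) auto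
qed

text \<open>
  Symmetry of mixed partials, where differentiability of \<open>fx\<close> in \<open>t\<close> is part of the conclusion:
  differentiate \<open>f t x = f 0 x + (\<integral> s from 0 to t. g s x)\<close> in \<open>x\<close> under the integral, then
  in \<open>t\<close>.
\<close>

lemma mixed_partial:
  fixes f g fx gx :: "real \<Rightarrow> real \<Rightarrow> real"
  assumes ft: "\<And>t x. t \<in> {0..b} \<Longrightarrow> ((\<lambda>s. f s x) has_real_derivative g t x) (at t within {0..b})"
    and fx: "\<And>t x. t \<in> {0..b} \<Longrightarrow> (f t has_real_derivative fx t x) (at x)"
    and gx: "\<And>t x. t \<in> {0..b} \<Longrightarrow> (g t has_real_derivative gx t x) (at x)"
    and cont_g: "continuous_on ({0..b} \<times> UNIV) (\<lambda>(t, x). g t x)"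
    and cont_gx: "continuous_on ({0..b} \<times> UNIV) (\<lambda>(t, x). gx t x)"
    and t: "t \<in> {0..b}"
  shows "((\<lambda>s. fx s x) has_real_derivative gx t x) (at t within {0..b})"
proof -
  have fx_eq: "fx s x = fx 0 x + integral {0..s} (\<lambda>r. gx r x)" if s: "s \<in> {0..b}" for s
  proof -
    have f_eq: "f s y = f 0 y + integral {0..s} (\<lambda>r. g r y)" for y
    proof -
      have "((\<lambda>r. g r y) has_integral f s y - f 0 y) {0..s}"
        by (intro fundamental_theorem_of_calculus)
          (use s in \<open>auto simp flip: has_real_derivative_iff_has_vector_derivative
            intro: DERIV_subset[OF ft]\<close>)
      then show ?thesis by (simp add: integral_unique)
    qed
    have "((\<lambda>y. integral (cbox 0 s) (\<lambda>r. g r y)) has_real_derivative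
        integral (cbox 0 s) (\<lambda>r. gx r x)) (at x within UNIV)"
    proof (rule leibniz_rule_field_derivative)
      show "continuous_on (UNIV \<times> cbox 0 s) (\<lambda>(y, r). gx r y)"
        unfolding case_prod_beta
        by (rule continuous_on_slab_compose[OF cont_gx])
          (use s in \<open>auto intro!: continuous_intros\<close>)
      show "(\<lambda>r. g r y) integrable_on cbox 0 s" for y
        by (intro integrable_continuous continuous_on_slab_compose[OF cont_g])
          (use s in \<open>auto intro!: continuous_intros\<close>)
      show "((\<lambda>y. g r y) has_real_derivative gx r y) (at y within UNIV)"
        if "r \<in> cbox 0 s" for y r
        using gx[of r y] that s by auto
    qed auto
    then have "((\<lambda>y. f 0 y + integral {0..s} (\<lambda>r. g r y)) has_real_derivative
        fx 0 x + integral {0..s} (\<lambda>r. gx r x)) (at x)"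
      using s by (intro DERIV_add fx) auto
    then have "(f s has_real_derivative fx 0 x + integral {0..s} (\<lambda>r. gx r x)) (at x)"
      using f_eq by presburger
    then show ?thesis using fx[OF s] DERIV_unique by blast
  qed
  have "((\<lambda>s. fx 0 x + integral {0..s} (\<lambda>r. gx r x)) has_real_derivative 0 + gx t x)
      (at t within {0..b})"
    by (intro DERIV_add DERIV_const integral_has_real_derivative
        continuous_on_slab_compose[OF cont_gx]) (use t in \<open>auto intro!: continuous_intros\<close>)
  then have "((\<lambda>s. fx 0 x + integral {0..s} (\<lambda>r. gx r x)) has_real_derivative gx t x)
      (at t within {0..b})" by simp
  then show ?thesis
    by (rule has_field_derivative_transform_within[where d = 1])
      (use t in \<open>auto intro: fx_eq[symmetric]\<close>)
qed

section \<open>The system for vorticity and density gradient\<close>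

text \<open>
  The vorticity \<open>w\<close> and the density gradient \<open>r\<close>, with spatial derivatives \<open>wx\<close> and \<open>rx\<close>, on the
  closed slab \<open>[0, b] \<times> \<real>\<close>, where suprema over compact space intervals are finite. The velocity
  is \<open>- c w\<close>.
\<close>

locale density_gradient_system =
  fixes c b :: real and w wx r rx :: "real \<Rightarrow> real \<Rightarrow> real"
  assumes c_pos: "0 < c" and b_nonneg: "0 \<le> b"
    and w_t: "t \<in> {0..b} \<Longrightarrow>
      ((\<lambda>s. w s x) has_real_derivative c * w t x * wx t x + r t x) (at t within {0..b})"
    and r_t: "t \<in> {0..b} \<Longrightarrow>
      ((\<lambda>s. r s x) has_real_derivative c * (wx t x * r t x + w t x * rx t x)) (at t within {0..b})"
    and w_x: "t \<in> {0..b} \<Longrightarrow> (w t has_real_derivative wx t x) (at x)"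
    and r_x: "t \<in> {0..b} \<Longrightarrow> (r t has_real_derivative rx t x) (at x)"
    and cont_w: "continuous_on ({0..b} \<times> UNIV) (\<lambda>(t, x). w t x)"
    and cont_wx: "continuous_on ({0..b} \<times> UNIV) (\<lambda>(t, x). wx t x)"
    and cont_r: "continuous_on ({0..b} \<times> UNIV) (\<lambda>(t, x). r t x)"
    and cont_rx: "continuous_on ({0..b} \<times> UNIV) (\<lambda>(t, x). rx t x)"
begin

lemmas slab_intros =
  continuous_on_slab_compose[OF cont_w] continuous_on_slab_compose[OF cont_wx]
  continuous_on_slab_compose[OF cont_r] continuous_on_slab_compose[OF cont_rx]

text \<open>
  Fix \<open>x\<close> and regard \<open>wx\<close> and \<open>rx\<close> at \<open>x\<close> as given bounded functions of time: the two equations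
  become a homogeneous linear system for \<open>(w, r)\<close> at \<open>x\<close>. The transport term \<open>w rx\<close> is one of its
  off-diagonal entries.
\<close>

lemma stagnation_point:
  assumes "w 0 x = 0" "r 0 x = 0" and t: "t \<in> {0..b}"
  shows "w t x = 0 \<and> r t x = 0"
proof -
  obtain P where P: "\<And>t y. t \<in> {0..b} \<Longrightarrow> y \<in> {x..x} \<Longrightarrow> \<bar>wx t y\<bar> \<le> P"
    using slab_bounded[OF cont_wx] by metis
  obtain Q where Q: "\<And>t y. t \<in> {0..b} \<Longrightarrow> y \<in> {x..x} \<Longrightarrow> \<bar>rx t y\<bar> \<le> Q"
    using slab_bounded[OF cont_rx] by metis
  show ?thesis
  proof (rule linear_system_zero[where p = "\<lambda>t. c * wx t x" and q = "\<lambda>t. c * rx t x"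
        and P = "c * P" and Q = "c * Q", OF _ _ _ _ _ _ t])
    fix s assume s: "s \<in> {0..b}"
    show "((\<lambda>t. w t x) has_real_derivative c * wx s x * w s x + r s x) (at s within {0..b})"
      using w_t[OF s, of x] by (simp add: algebra_simps)
    show "((\<lambda>t. r t x) has_real_derivative c * rx s x * w s x + c * wx s x * r s x)
        (at s within {0..b})"
      using r_t[OF s, of x] by (simp add: algebra_simps)
    show "\<bar>c * wx s x\<bar> \<le> c * P" "\<bar>c * rx s x\<bar> \<le> c * Q"
      using P[OF s] Q[OF s] c_pos by (simp_all add: abs_mult)
  qed (use assms in auto)
qed

text \<open>
  Minimum principle. After multiplication by \<open>exp (- K t)\<close> the zeroth order coefficient
  \<open>c wx - K\<close> is negative. At a negative minimum, which lies off the parabolic boundary, the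
  transport term vanishes and the time derivative would be strictly positive, although the
  values at earlier times are no smaller.
\<close>

lemma density_gradient_nonneg:
  assumes init: "\<And>x. x \<in> {\<alpha>..\<beta>} \<Longrightarrow> 0 \<le> r 0 x"
    and bdry: "\<And>t. t \<in> {0..b} \<Longrightarrow> r t \<alpha> = 0 \<and> r t \<beta> = 0"
    and t: "t \<in> {0..b}" and x: "x \<in> {\<alpha>..\<beta>}"
  shows "0 \<le> r t x"
proof (rule ccontr)
  assume neg: "\<not> 0 \<le> r t x"
  obtain M where M: "\<And>t x. t \<in> {0..b} \<Longrightarrow> x \<in> {\<alpha>..\<beta>} \<Longrightarrow> \<bar>wx t x\<bar> \<le> M"
    using slab_bounded[OF cont_wx] by metis
  define K where "K = c * M + 1"
  define v where "v t x = exp (- K * t) * r t x" for t x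
  have "continuous_on ({0..b} \<times> {\<alpha>..\<beta>}) (\<lambda>z. v (fst z) (snd z))"
    unfolding v_def by (intro continuous_intros slab_intros) auto
  then obtain z where z: "z \<in> {0..b} \<times> {\<alpha>..\<beta>}"
    and min: "\<And>z'. z' \<in> {0..b} \<times> {\<alpha>..\<beta>} \<Longrightarrow> v (fst z) (snd z) \<le> v (fst z') (snd z')"
    using continuous_attains_inf[OF compact_Times[OF compact_Icc compact_Icc], of 0 b \<alpha> \<beta>
        "\<lambda>z. v (fst z) (snd z)"] t x
    by blast
  obtain s y where zsy: "z = (s, y)" by force
  have s: "s \<in> {0..b}" and y: "y \<in> {\<alpha>..\<beta>}" using z zsy by auto
  have vmin: "v s y \<le> v s' y'" if "s' \<in> {0..b}" "y' \<in> {\<alpha>..\<beta>}" for s' y'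
    using min[of "(s', y')"] that zsy by simp
  have "v t x < 0" using neg by (simp add: v_def mult_less_0_iff)
  then have "v s y < 0" using vmin[OF t x] by simp
  then have rneg: "r s y < 0" by (simp add: v_def mult_less_0_iff)
  have "s \<noteq> 0" using init[OF y] rneg by auto
  then have spos: "0 < s" using s by simp
  have "y \<noteq> \<alpha>" "y \<noteq> \<beta>" using bdry[OF s] rneg by auto
  then have yint: "\<alpha> < y" "y < \<beta>" using y by auto
  have "rx s y = 0"
  proof (rule DERIV_local_min[OF r_x[OF s]])
    show "0 < min (y - \<alpha>) (\<beta> - y)" using yint by simp
    show "\<forall>y'. \<bar>y - y'\<bar> < min (y - \<alpha>) (\<beta> - y) \<longrightarrow> r s y \<le> r s y'"
    proof (intro allI impI)
      fix y' assume "\<bar>y - y'\<bar> < min (y - \<alpha>) (\<beta> - y)"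
      then have "y' \<in> {\<alpha>..\<beta>}" by (simp add: abs_less_iff)
      then show "r s y \<le> r s y'" using vmin[OF s] by (simp add: v_def)
    qed
  qed
  then have "((\<lambda>t. r t y) has_real_derivative c * wx s y * r s y) (at s within {0..b})"
    using r_t[OF s, of y] by (simp add: algebra_simps)
  then have "((\<lambda>t. v t y) has_real_derivative exp (- K * s) * ((c * wx s y - K) * r s y))
      (at s within {0..b})"
    unfolding v_def by (auto intro!: derivative_eq_intros simp: algebra_simps)
  moreover have "c * wx s y < K"
  proof -
    have "c * wx s y \<le> c * M"
      using M[OF s y] c_pos by (intro mult_left_mono) auto
    then show ?thesis by (simp add: K_def)
  qed
  then have "0 < exp (- K * s) * ((c * wx s y - K) * r s y)"
    using rneg by (simp add: mult_neg_neg)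
  ultimately obtain d where d: "0 < d"
    "\<And>h. 0 < h \<Longrightarrow> s - h \<in> {0..b} \<Longrightarrow> h < d \<Longrightarrow> v (s - h) y < v s y"
    using has_real_derivative_pos_inc_left by metis
  \<comment> \<open>A step back in time that stays in the slab, since \<open>s > 0\<close>, and within \<open>d\<close>.\<close>
  define h where "h = min s (d / 2)"
  have "v (s - h) y < v s y"
    using d(1) spos s by (intro d(2)) (auto simp: h_def min_def)
  moreover have "v s y \<le> v (s - h) y"
    using vmin[OF _ y, of "s - h"] d(1) spos s by (auto simp: h_def min_def)
  ultimately show False by simp
qed

text \<open>
  The functional \<open>F\<close> with the weight \<open>1/x\<close> regularized to \<open>1/(x + \<delta>)\<close>, which is smooth on
  \<open>[0, a]\<close>.
\<close>

definition moment :: "real \<Rightarrow> real \<Rightarrow> real \<Rightarrow> real" where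
  "moment a \<delta> t = c * integral {0..a} (\<lambda>x. w t x / (x + \<delta>))"

lemma moment_has_derivative:
  assumes "0 < \<delta>" and t: "t \<in> {0..b}"
  shows "(moment a \<delta> has_real_derivative
      c * integral {0..a} (\<lambda>x. (c * w t x * wx t x + r t x) / (x + \<delta>))) (at t within {0..b})"
proof -
  have "((\<lambda>t. integral (cbox 0 a) (\<lambda>x. w t x / (x + \<delta>))) has_real_derivative
      integral (cbox 0 a) (\<lambda>x. (c * w t x * wx t x + r t x) / (x + \<delta>))) (at t within {0..b})"
  proof (rule leibniz_rule_field_derivative[OF _ _ _ t])
    show "((\<lambda>t. w t x / (x + \<delta>)) has_real_derivative
        (c * w s x * wx s x + r s x) / (x + \<delta>)) (at s within {0..b})"
      if "s \<in> {0..b}" for s x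
      by (intro DERIV_cdivide w_t that)
    show "(\<lambda>x. w s x / (x + \<delta>)) integrable_on cbox 0 a" if "s \<in> {0..b}" for s
      by (intro integrable_continuous continuous_intros slab_intros)
        (use that \<open>0 < \<delta>\<close> in auto)
    show "continuous_on ({0..b} \<times> cbox 0 a)
        (\<lambda>(s, x). (c * w s x * wx s x + r s x) / (x + \<delta>))"
      unfolding case_prod_beta
      by (intro continuous_intros slab_intros) (use \<open>0 < \<delta>\<close> in auto)
  qed simp
  then show ?thesis
    unfolding moment_def [abs_def] by (auto intro: DERIV_cmult)
qed

text \<open>
  With \<open>h = w/(x + \<delta>)\<close> and \<open>w\<close> vanishing at the ends, integration by parts turns
  \<open>\<integral> w wx/(x + \<delta>)\<close> into \<open>1/2 \<integral> h\<^sup>2\<close>. The shift \<open>\<delta>\<close> leaves this identity intact, because \<open>1/(x + \<delta>)\<close>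
  has derivative \<open>- 1/(x + \<delta>)\<^sup>2\<close> just as \<open>1/x\<close> has derivative \<open>- 1/x\<^sup>2\<close>. The Cauchy-Schwarz
  inequality \<open>\<integral> h\<^sup>2 \<ge> (\<integral> h)\<^sup>2/a\<close> is used in the pointwise form \<open>h\<^sup>2 \<ge> 2 m h - m\<^sup>2\<close>, where \<open>m\<close> is the
  mean of \<open>h\<close>.
\<close>

lemma moment_riccati:
  assumes "0 < \<delta>" "0 < a" and t: "t \<in> {0..b}"
    and bdry: "w t 0 = 0" "w t a = 0"
    and nonneg: "\<And>x. x \<in> {0..a} \<Longrightarrow> 0 \<le> r t x"
  shows "(moment a \<delta> t)\<^sup>2 / (2 * a) \<le>
    c * integral {0..a} (\<lambda>x. (c * w t x * wx t x + r t x) / (x + \<delta>))"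
proof -
  define h where "h x = w t x / (x + \<delta>)" for x
  define m where "m = integral {0..a} h / a"
  have [simp]: "x + \<delta> \<noteq> 0" if "0 \<le> x" for x using that \<open>0 < \<delta>\<close> by simp
  have h: "(h has_integral m * a) {0..a}"
  proof -
    have "h integrable_on {0..a}" unfolding h_def
      by (intro integrable_continuous_real continuous_intros slab_intros) (use t in auto)
    then show ?thesis using \<open>0 < a\<close> by (simp add: m_def has_integral_integral)
  qed
  have parts: "((\<lambda>x. w t x * wx t x / (x + \<delta>) - (h x)\<^sup>2 / 2) has_integral
      (w t a)\<^sup>2 / (2 * (a + \<delta>)) - (w t 0)\<^sup>2 / (2 * (0 + \<delta>))) {0..a}"
  proof (rule fundamental_theorem_of_calculus)
    fix x assume x: "x \<in> {0..a}"
    have num: "((\<lambda>x. (w t x)\<^sup>2) has_real_derivative 2 * w t x * wx t x) (at x)"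
      by (auto intro!: derivative_eq_intros w_x[OF t])
    have den: "((\<lambda>x. 2 * (x + \<delta>)) has_real_derivative 2) (at x)"
      by (auto intro!: derivative_eq_intros)
    \<comment> \<open>The quotient rule with \<open>e = x + \<delta>\<close>.\<close>
    have quotient: "(2 * p * q * (2 * e) - p\<^sup>2 * 2) / (2 * e * (2 * e)) = p * q / e - (p / e)\<^sup>2 / 2"
      if "e \<noteq> 0" for p q e :: real
      using that by (simp add: field_simps power2_eq_square)
    have nonzero: "x + \<delta> \<noteq> 0" "2 * (x + \<delta>) \<noteq> 0"
      using x \<open>0 < \<delta>\<close> by auto
    have "((\<lambda>x. (w t x)\<^sup>2 / (2 * (x + \<delta>))) has_real_derivative
        w t x * wx t x / (x + \<delta>) - (h x)\<^sup>2 / 2) (at x)"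
      unfolding h_def quotient[OF nonzero(1), symmetric]
      by (rule DERIV_divide[OF num den nonzero(2)])
    then show "((\<lambda>x. (w t x)\<^sup>2 / (2 * (x + \<delta>))) has_vector_derivative
        w t x * wx t x / (x + \<delta>) - (h x)\<^sup>2 / 2) (at x within {0..a})"
      by (simp add: has_real_derivative_iff_has_vector_derivative
          has_vector_derivative_at_within)
  qed (use \<open>0 < a\<close> in simp)
  \<comment> \<open>A minorant of the integrand whose integral is known: the first summand integrates to \<open>0\<close>,
     the second to \<open>c/2\<close> times the square of the integral of \<open>h\<close>, divided by \<open>a\<close>.\<close>
  have lower: "((\<lambda>x. c * (w t x * wx t x / (x + \<delta>) - (h x)\<^sup>2 / 2) + c / 2 * (2 * m * h x - m\<^sup>2))
      has_integral c * 0 + c / 2 * (2 * m * (m * a) - m\<^sup>2 * a)) {0..a}"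
    using parts has_integral_const_real[of "m\<^sup>2" 0 a] \<open>0 < a\<close> bdry
    by (intro has_integral_add has_integral_mult_right has_integral_diff h)
      (auto simp: mult.commute)
  have "c * 0 + c / 2 * (2 * m * (m * a) - m\<^sup>2 * a) \<le>
      integral {0..a} (\<lambda>x. (c * w t x * wx t x + r t x) / (x + \<delta>))"
  proof (rule has_integral_le[OF lower integrable_integral])
    show "(\<lambda>x. (c * w t x * wx t x + r t x) / (x + \<delta>)) integrable_on {0..a}"
      by (intro integrable_continuous_real continuous_intros slab_intros) (use t in auto)
  next
    fix x assume x: "x \<in> {0..a}"
    have "2 * m * h x - m\<^sup>2 \<le> (h x)\<^sup>2"
      using sum_squares_bound[of m "h x"] by simp
    then have "c / 2 * (2 * m * h x - m\<^sup>2) \<le> c / 2 * (h x)\<^sup>2"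
      using c_pos by (intro mult_left_mono) auto
    moreover have "0 \<le> r t x / (x + \<delta>)"
      using nonneg[OF x] x \<open>0 < \<delta>\<close> by simp
    ultimately show "c * (w t x * wx t x / (x + \<delta>) - (h x)\<^sup>2 / 2) +
        c / 2 * (2 * m * h x - m\<^sup>2) \<le> (c * w t x * wx t x + r t x) / (x + \<delta>)"
      by (simp add: add_divide_distrib algebra_simps)
  qed
  then have "c * (c / 2 * (m\<^sup>2 * a)) \<le>
      c * integral {0..a} (\<lambda>x. (c * w t x * wx t x + r t x) / (x + \<delta>))"
    using c_pos by (intro mult_left_mono) (simp_all add: power2_eq_square mult_ac)
  moreover have "moment a \<delta> t = c * (m * a)"
    using h by (simp add: moment_def h_def[abs_def] integral_unique)
  ultimately show ?thesis
    using \<open>0 < a\<close> by (simp add: power2_eq_square field_simps)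
qed

lemma slab_length_bound:
  assumes "0 < a" "0 < \<delta>"
    and "w 0 0 = 0" "w 0 a = 0" "r 0 0 = 0" "r 0 a = 0"
    and "\<And>x. x \<in> {0..a} \<Longrightarrow> 0 \<le> r 0 x"
    and "0 < moment a \<delta> 0"
  shows "b < 2 * a / moment a \<delta> 0"
proof -
  have at_0: "w t 0 = 0 \<and> r t 0 = 0" and at_a: "w t a = 0 \<and> r t a = 0" if "t \<in> {0..b}" for t
    using stagnation_point that assms(3-6) by blast+
  show ?thesis
  proof (rule riccati_lifespan[OF moment_has_derivative moment_riccati])
    show "0 \<le> r t x" if "t \<in> {0..b}" "x \<in> {0..a}" for t x
      using density_gradient_nonneg[OF assms(7) _ that] at_0 at_a by blast
  qed (use assms at_0 at_a b_nonneg in simp_all)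
qed

end

section \<open>Smooth solutions\<close>

lemma Ck_on_imp_continuous_on:
  assumes "Ck_on k S f" shows "continuous_on S f"
proof (cases k)
  case (Suc j)
  then show ?thesis
    using assms by (auto simp: continuous_on_eq_continuous_within intro: has_derivative_continuous)
qed (use assms in auto)

text \<open>
  The total derivative within the slab, evaluated at the two coordinate directions, gives the
  partial derivatives along the slices; in time they are one-sided at an endpoint of \<open>I\<close>.
\<close>

lemma Ck_on_Suc_slab:
  fixes f :: "real \<Rightarrow> real \<Rightarrow> real"
  assumes "Ck_on (Suc k) (I \<times> UNIV) (\<lambda>(t, x). f t x)"
  obtains ft fx where
    "\<And>t x. t \<in> I \<Longrightarrow> ((\<lambda>s. f s x) has_real_derivative ft t x) (at t within I)"
    "\<And>t x. t \<in> I \<Longrightarrow> (f t has_real_derivative fx t x) (at x)"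
    "Ck_on k (I \<times> UNIV) (\<lambda>(t, x). fx t x)"
proof -
  obtain f' where f': "\<And>z. z \<in> I \<times> UNIV \<Longrightarrow>
      ((\<lambda>(t, x). f t x) has_derivative f' z) (at z within I \<times> UNIV)"
    and Ck: "\<And>v. Ck_on k (I \<times> UNIV) (\<lambda>z. f' z v)"
    using assms by auto
  show thesis
  proof
    fix t x assume t: "t \<in> I"
    have lin: "linear (f' (t, x))"
      using f'[of "(t, x)"] t by (simp add: has_derivative_linear)
    have "((\<lambda>s. (\<lambda>(t, x). f t x) (s, x)) has_derivative (\<lambda>h. f' (t, x) (h, 0))) (at t within I)"
      by (rule has_derivative_in_compose2[where t = "I \<times> UNIV"])
        (use t f' in \<open>auto intro!: derivative_eq_intros\<close>)
    moreover have "(\<lambda>h. f' (t, x) (h, 0)) = (*) (f' (t, x) (1, 0))"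
    proof
      show "f' (t, x) (h, 0) = f' (t, x) (1, 0) * h" for h
        using linear_cmul[OF lin, of h "(1, 0)"] by simp
    qed
    ultimately show "((\<lambda>s. f s x) has_real_derivative f' (t, x) (1, 0)) (at t within I)"
      by (simp only: has_field_derivative_def prod.case)
    have "((\<lambda>y. (\<lambda>(t, x). f t x) (t, y)) has_derivative (\<lambda>h. f' (t, x) (0, h))) (at x within UNIV)"
      by (rule has_derivative_in_compose2[where t = "I \<times> UNIV"])
        (use t f' in \<open>auto intro!: derivative_eq_intros\<close>)
    moreover have "(\<lambda>h. f' (t, x) (0, h)) = (*) (f' (t, x) (0, 1))"
    proof
      show "f' (t, x) (0, h) = f' (t, x) (0, 1) * h" for h
        using linear_cmul[OF lin, of h "(0, 1)"] by simp
    qed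
    ultimately show "(f t has_real_derivative f' (t, x) (0, 1)) (at x)"
      by (simp only: has_field_derivative_def prod.case)
  next
    show "Ck_on k (I \<times> UNIV) (\<lambda>(t, x). f' (t, x) (0, 1))"
      using Ck[of "(0, 1)"] unfolding case_prod_unfold prod.collapse .
  qed
qed

lemma Icc_subset_time_interval:
  assumes "0 \<le> t" "ereal u < T"
  shows "{t..u} \<subseteq> time_interval T"
  using assms le_less_trans[of "ereal _" "ereal u" T] by (auto simp: time_interval_def)

text \<open>
  Makes derivatives within the time interval unique, so that \<open>partial_t\<close> is the derivative that
  smoothness provides.
\<close>

lemma time_interval_at_within_nontrivial:
  assumes "t \<in> time_interval T"
  shows "at t within time_interval T \<noteq> bot"
proof -
  obtain u where u: "t < u" "ereal u < T"
    using assms ereal_dense2[of "ereal t" T] by (auto simp: time_interval_def)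
  then have "{t..u} \<subseteq> time_interval T"
    using assms by (intro Icc_subset_time_interval) (auto simp: time_interval_def)
  moreover have "t islimpt {t..u}" using u by (simp add: islimpt_Icc)
  ultimately show ?thesis
    by (meson islimpt_subset trivial_limit_within)
qed

text \<open>
  The equation for \<open>r = \<theta>\<^sub>x\<close> is the one for \<open>\<theta>\<close>
  differentiated in \<open>x\<close>, and \<open>mixed_partial\<close> turns \<open>\<partial>\<^sub>x \<theta>\<^sub>t\<close> into \<open>r\<^sub>t\<close>.
\<close>

lemma smooth_solution_restrict:
  assumes sol: "smooth_solution L c T \<omega> \<theta>" and "0 < c" "0 \<le> b" "ereal b < T"
  obtains wx r rx where "density_gradient_system c b \<omega> wx r rx"
    "r 0 = deriv (\<theta> 0)"
proof -
  define I where "I = time_interval T"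
  have Ib: "{0..b} \<subseteq> I"
    using \<open>ereal b < T\<close> by (simp add: I_def Icc_subset_time_interval)
  have smooth: "\<And>k. Ck_on k (I \<times> UNIV) (\<lambda>(t, x). \<omega> t x)"
    "\<And>k. Ck_on k (I \<times> UNIV) (\<lambda>(t, x). \<theta> t x)"
    and pde: "\<And>t x. t \<in> I \<Longrightarrow> partial_t T \<omega> t x - c * \<omega> t x * partial_x \<omega> t x = partial_x \<theta> t x"
    "\<And>t x. t \<in> I \<Longrightarrow> partial_t T \<theta> t x - c * \<omega> t x * partial_x \<theta> t x = 0"
    using sol by (auto simp: smooth_solution_def smooth_on_def I_def)
  obtain wt wx where
    w_t: "\<And>t x. t \<in> I \<Longrightarrow> ((\<lambda>s. \<omega> s x) has_real_derivative wt t x) (at t within I)"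
    and w_x: "\<And>t x. t \<in> I \<Longrightarrow> (\<omega> t has_real_derivative wx t x) (at x)"
    and C_wx: "Ck_on 0 (I \<times> UNIV) (\<lambda>(t, x). wx t x)"
    using Ck_on_Suc_slab[OF smooth(1)[of "Suc 0"]] by metis
  obtain \<theta>t r where
    \<theta>_t: "\<And>t x. t \<in> I \<Longrightarrow> ((\<lambda>s. \<theta> s x) has_real_derivative \<theta>t t x) (at t within I)"
    and \<theta>_x: "\<And>t x. t \<in> I \<Longrightarrow> (\<theta> t has_real_derivative r t x) (at x)"
    and C_r: "Ck_on (Suc 0) (I \<times> UNIV) (\<lambda>(t, x). r t x)"
    using Ck_on_Suc_slab[OF smooth(2)[of "Suc (Suc 0)"]] by metis
  obtain rx where
    r_x: "\<And>t x. t \<in> I \<Longrightarrow> (r t has_real_derivative rx t x) (at x)"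
    and C_rx: "Ck_on 0 (I \<times> UNIV) (\<lambda>(t, x). rx t x)"
    using Ck_on_Suc_slab[OF C_r] by metis
  have pt: "partial_t T f t x = y"
    if "((\<lambda>s. f s x) has_real_derivative y) (at t within I)" "t \<in> I" for f t x y
    using that time_interval_at_within_nontrivial[of t T]
    by (simp add: partial_t_def I_def has_real_derivative_iff_has_vector_derivative
        vector_derivative_within)
  have wt_eq: "wt t x = c * \<omega> t x * wx t x + r t x"
    and \<theta>t_eq: "\<theta>t t x = c * \<omega> t x * r t x" if "t \<in> I" for t x
    using pde[OF that, of x] pt[OF w_t[OF that] that] pt[OF \<theta>_t[OF that] that]
      DERIV_imp_deriv[OF w_x[OF that]] DERIV_imp_deriv[OF \<theta>_x[OF that]]
    by (auto simp: partial_x_def)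
  note cont = Ck_on_imp_continuous_on[OF smooth(1)[of 0]] Ck_on_imp_continuous_on[OF C_wx]
    Ck_on_imp_continuous_on[OF C_r] Ck_on_imp_continuous_on[OF C_rx]
  note cont_b = cont[THEN continuous_on_subset, of "{0..b} \<times> UNIV", OF Sigma_mono[OF Ib order_refl]]
  have "density_gradient_system c b \<omega> wx r rx"
  proof
    fix t x assume t: "t \<in> {0..b}"
    then have tI: "t \<in> I" using Ib by auto
    show "((\<lambda>s. \<omega> s x) has_real_derivative c * \<omega> t x * wx t x + r t x) (at t within {0..b})"
      using DERIV_subset[OF w_t[OF tI] Ib] wt_eq[OF tI] by simp
    show "((\<lambda>s. r s x) has_real_derivative c * (wx t x * r t x + \<omega> t x * rx t x))
        (at t within {0..b})"
    proof (rule mixed_partial[where f = \<theta> and fx = r and g = "\<lambda>t x. c * \<omega> t x * r t x"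
          and gx = "\<lambda>t x. c * (wx t x * r t x + \<omega> t x * rx t x)", OF _ _ _ _ _ t])
      fix t x assume "t \<in> {0..b}"
      then have tI: "t \<in> I" using Ib by auto
      show "((\<lambda>s. \<theta> s x) has_real_derivative c * \<omega> t x * r t x) (at t within {0..b})"
        using DERIV_subset[OF \<theta>_t[OF tI] Ib] \<theta>t_eq[OF tI] by simp
      show "(\<theta> t has_real_derivative r t x) (at x)"
        using \<theta>_x tI by blast
      show "((\<lambda>x. c * \<omega> t x * r t x) has_real_derivative c * (wx t x * r t x + \<omega> t x * rx t x))
          (at x)"
        by (auto intro!: derivative_eq_intros w_x[OF tI] r_x[OF tI] simp: algebra_simps)
    next
      show "continuous_on ({0..b} \<times> UNIV) (\<lambda>(t, x). c * \<omega> t x * r t x)"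
        "continuous_on ({0..b} \<times> UNIV) (\<lambda>(t, x). c * (wx t x * r t x + \<omega> t x * rx t x))"
        unfolding case_prod_beta
        by (auto intro!: continuous_intros continuous_on_slab_compose[OF cont_b(1)]
            continuous_on_slab_compose[OF cont_b(2)] continuous_on_slab_compose[OF cont_b(3)]
            continuous_on_slab_compose[OF cont_b(4)])
    qed
  qed (use \<open>0 < c\<close> \<open>0 \<le> b\<close> cont_b w_x r_x Ib in auto)
  moreover have "r 0 = deriv (\<theta> 0)"
    using \<theta>_x[of 0] Ib \<open>0 \<le> b\<close> by (intro ext DERIV_imp_deriv[symmetric]) auto
  ultimately show thesis by (rule that)
qed

text \<open>
  Dominated convergence with the limit itself as the bound, since the nonnegative integrand
  increases as the shift decreases. At \<open>x = 0\<close> all the quotients are \<open>0\<close>: the shifted ones because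
  \<open>f 0 = 0\<close>, the limit by the convention for division by zero.
\<close>

lemma regularized_integral_tendsto:
  fixes f :: "real \<Rightarrow> real"
  assumes cont: "continuous_on {0..a} f" and "f 0 = 0"
    and nonneg: "\<And>x. x \<in> {0..a} \<Longrightarrow> 0 \<le> f x"
    and int: "(\<lambda>x. f x / x) integrable_on {0..a}"
  shows "(\<lambda>n. integral {0..a} (\<lambda>x. f x / (x + 1 / real (Suc n))))
    \<longlonglongrightarrow> integral {0..a} (\<lambda>x. f x / x)"
proof (rule dominated_convergence(2)[OF _ int])
  fix n
  have "x + 1 / real (Suc n) \<noteq> 0" if "0 \<le> x" for x
    by (metis add_nonneg_pos less_irrefl of_nat_0_less_iff that zero_less_Suc zero_less_divide_1_iff)
  then show "(\<lambda>x. f x / (x + 1 / real (Suc n))) integrable_on {0..a}"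
    by (intro integrable_continuous_real continuous_intros cont) auto
next
  fix n x assume x: "x \<in> {0..a}"
  show "norm (f x / (x + 1 / real (Suc n))) \<le> f x / x"
  proof (cases "x = 0")
    case False
    then have "f x / (x + 1 / real (Suc n)) \<le> f x / x"
      using x nonneg[OF x] by (intro divide_left_mono mult_pos_pos add_pos_pos) auto
    then show ?thesis using x nonneg[OF x] by simp
  qed (use \<open>f 0 = 0\<close> in simp)
next
  fix x assume x: "x \<in> {0..a}"
  show "(\<lambda>n. f x / (x + 1 / real (Suc n))) \<longlonglongrightarrow> f x / x"
  proof (cases "x = 0")
    case False
    have "(\<lambda>n. f x / (x + 1 / real (Suc n))) \<longlonglongrightarrow> f x / (x + 0)"
      using False LIMSEQ_inverse_real_of_nat
      by (intro tendsto_intros) (auto simp: inverse_eq_divide)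
    then show ?thesis by simp
  qed (use \<open>f 0 = 0\<close> in simp)
qed

text \<open>
  Every slab \<open>[0, b]\<close> with \<open>b < T\<close> is shorter than \<open>2 a\<close> over the regularized functional at time
  \<open>0\<close>, for all small shifts; the limit is taken in this bound, at fixed \<open>b\<close>.
\<close>

lemma smooth_solution_lifespan_bound:
  fixes \<omega> \<theta> :: "real \<Rightarrow> real \<Rightarrow> real"
  assumes "0 < a" "0 < c"
    and sol: "smooth_solution L c T \<omega> \<theta>"
    and w0: "\<omega> 0 0 = 0" "\<omega> 0 a = 0" "deriv (\<theta> 0) 0 = 0" "deriv (\<theta> 0) a = 0"
    and nonneg: "\<And>x. x \<in> {0..a} \<Longrightarrow> 0 \<le> \<omega> 0 x" "\<And>x. x \<in> {0..a} \<Longrightarrow> 0 \<le> deriv (\<theta> 0) x"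
    and pos: "0 < c * integral {0..a} (\<lambda>x. \<omega> 0 x / x)"
  shows "T \<le> ereal (2 * a / (c * integral {0..a} (\<lambda>x. \<omega> 0 x / x)))"
proof (rule dense_le)
  fix T' assume "T' < T"
  define F where "F = c * integral {0..a} (\<lambda>x. \<omega> 0 x / x)"
  define F\<^sub>n where "F\<^sub>n n = c * integral {0..a} (\<lambda>x. \<omega> 0 x / (x + 1 / real (Suc n)))" for n
  have "T' \<le> ereal (2 * a / F)"
  proof (cases "T' \<le> 0")
    case True
    then show ?thesis
      using \<open>0 < a\<close> pos by (auto simp: F_def intro: order_trans)
  next
    case False
    then obtain b where b: "T' = ereal b" "0 \<le> b" "ereal b < T"
      using \<open>T' < T\<close> by (cases T') auto
    obtain wx r rx where sys: "density_gradient_system c b \<omega> wx r rx"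
      and r0: "r 0 = deriv (\<theta> 0)"
      using smooth_solution_restrict[OF sol \<open>0 < c\<close> b(2,3)] by metis
    interpret density_gradient_system c b \<omega> wx r rx by (fact sys)
    have "continuous_on {0..a} (\<omega> 0)"
      using b(2) by (intro slab_intros(1)[of _ "\<lambda>_. 0" "\<lambda>x. x"] continuous_intros) auto
    \<comment> \<open>Otherwise the integral would be \<open>0\<close> by convention, against its positivity.\<close>
    moreover have "(\<lambda>x. \<omega> 0 x / x) integrable_on {0..a}"
      using pos not_integrable_integral by fastforce
    ultimately have lim: "F\<^sub>n \<longlonglongrightarrow> F"
      unfolding F\<^sub>n_def[abs_def] F_def
      by (intro tendsto_mult_left regularized_integral_tendsto w0 nonneg)
    have "0 < F" using pos by (simp add: F_def)
    have "eventually (\<lambda>n. b \<le> 2 * a / F\<^sub>n n) sequentially"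
      using order_tendstoD(1)[OF lim \<open>0 < F\<close>]
    proof eventually_elim
      case (elim n)
      then have "b < 2 * a / moment a (1 / real (Suc n)) 0"
        using assms r0 by (intro slab_length_bound) (auto simp: moment_def F\<^sub>n_def)
      then show ?case by (simp add: moment_def F\<^sub>n_def)
    qed
    moreover have "(\<lambda>n. 2 * a / F\<^sub>n n) \<longlonglongrightarrow> 2 * a / F"
      using lim \<open>0 < F\<close> by (intro tendsto_intros) auto
    ultimately have "b \<le> 2 * a / F"
      by (intro tendsto_lowerbound) auto
    then show ?thesis using b by simp
  qed
  then show "T' \<le> ereal (2 * a / (c * integral {0..a} (\<lambda>x. \<omega> 0 x / x)))"
    by (simp add: F_def)
qed

theorem theorem5p1:
  fixes L c :: real
    and \<omega>0 \<theta>0 :: "real \<Rightarrow> real"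
    and T :: ereal
    and \<omega> \<theta> :: "real \<Rightarrow> real \<Rightarrow> real"
  assumes "0 < L" and "0 < c"
    and "periodic_fun_simple \<omega>0 L" and "smooth_on UNIV \<omega>0"
    and "periodic_fun_simple \<theta>0 L" and "smooth_on UNIV \<theta>0"
    and "odd_about \<omega>0 0" and "odd_about \<omega>0 (L/2)"
    and "odd_about (deriv \<theta>0) 0" and "odd_about (deriv \<theta>0) (L/2)"
    and "\<And>x. 0 \<le> x \<Longrightarrow> x \<le> L/2 \<Longrightarrow> 0 \<le> \<omega>0 x"
    and "\<And>x. 0 \<le> x \<Longrightarrow> x \<le> L/2 \<Longrightarrow> 0 \<le> deriv \<theta>0 x"
    and "smooth_solution L c T \<omega> \<theta>"
    and "\<omega> 0 = \<omega>0" and "\<theta> 0 = \<theta>0"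
    and "0 < F_functional L c \<omega> 0"
  shows "blows_up_in_finite_time L c T \<omega> \<theta> \<and>
         maximal_lifespan L c T \<omega> \<theta> \<le> ereal (L / F_functional L c \<omega> 0) \<and>
         (L = 2 \<longrightarrow> maximal_lifespan L c T \<omega> \<theta> \<le> ereal (2 / F_functional L c \<omega> 0))"
proof -
  have odd_zero: "f x0 = 0" if "odd_about f x0" for f x0
  proof -
    have "f (x0 + 0) = - f (x0 - 0)" using that unfolding odd_about_def by blast
    then show ?thesis by simp
  qed
  have "maximal_lifespan L c T \<omega> \<theta> \<le> ereal (L / F_functional L c \<omega> 0)"
    unfolding maximal_lifespan_def
  proof (rule Sup_least, clarify)
    fix T' \<omega>' \<theta>'
    assume sol: "smooth_solution L c T' \<omega>' \<theta>'"
      and agree: "\<forall>t\<in>time_interval T. \<omega>' t = \<omega> t \<and> \<theta>' t = \<theta> t"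
    have "0 \<in> time_interval T"
      using \<open>smooth_solution L c T \<omega> \<theta>\<close>
      by (simp add: smooth_solution_def time_interval_def flip: zero_ereal_def)
    then have init: "\<omega>' 0 = \<omega>0" "\<theta>' 0 = \<theta>0"
      using agree assms by auto
    have "T' \<le> ereal (2 * (L/2) / (c * integral {0..L/2} (\<lambda>x. \<omega>' 0 x / x)))"
    proof (rule smooth_solution_lifespan_bound[OF _ \<open>0 < c\<close> sol])
      show "\<omega>' 0 0 = 0" "\<omega>' 0 (L/2) = 0" "deriv (\<theta>' 0) 0 = 0" "deriv (\<theta>' 0) (L/2) = 0"
        unfolding init by (intro odd_zero assms)+
    qed (use assms init in \<open>auto simp: F_functional_def\<close>)
    then show "T' \<le> ereal (L / F_functional L c \<omega> 0)"
      using init assms by (simp add: F_functional_def)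
  qed
  then show ?thesis
    by (auto simp: blows_up_in_finite_time_def intro: le_less_trans)
qed

end
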